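(* Let $H$ be a 1-extendable graph and let $G\in\mathcal{E}(H)$. Then $G$ is maximal in $(\mathcal{E}(H),\subseteq)$ if and only if each maximal barrier of $G$ is a clique in $G$, the set $\mathcal{P}(G)$ of maximal barriers of $G$ is a cover set of $H$, and $\mathcal{P}(G)$ is maximal in $(\mathcal{C}(H),\preceq)$.
   Context: All graphs are finite and simple. $\Phi(G)$ is the number of perfect matchings of $G$. An edge is extendable if it lies in some perfect matching. A connected graph is 1-extendable if every edge is extendable. For $S\subseteq V(G)$, $\operatorname{odd}(G-S)$ is the number of odd-order components of $G-S$; $S$ is a barrier of $G$ if $\operatorname{odd}(G-S)=|S|$ (the empty set counts as a barrier); maximal barriers are the inclusion-maximal ones, and $\mathcal{P}(G)$ is the set of maximal barriers of $G$. For a 1-extendable $H$, $\mathcal{E}(H)=\{G\supseteq H: V(G)=V(H),\ \Phi(G)=\Phi(H)\}$, ordered by the subgraph relation $\subseteq$. Two barriers $B_1,B_2$ of $H$ conflict if $B_1\cap B_2\neq\emptyset$, or $B_1$ intersects at least two components of $H-B_2$, or $B_2$ intersects at least two components of $H-B_1$. A cover set of $H$ is a set $\mathcal{I}$ of barriers of $H$ that are pairwise non-conflicting and that form a partition of $V(H)$; $\mathcal{C}(H)$ is the family of cover sets. For $\mathcal{I}_1,\mathcal{I}_2\in\mathcal{C}(H)$, $\mathcal{I}_1\preceq\mathcal{I}_2$ means every $B_1\in\mathcal{I}_1$ is contained in some $B_2\in\mathcal{I}_2$.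
   Formalization: H is assumed to have at least two vertices; the one-vertex graph, vacuously 1-extendable by the stated definition, is excluded because it is maximal in E(H) but has no barriers, so the equivalence fails for it. *)

theory Defs
  imports Main "HOL-Library.Disjoint_Sets"
begin

text \<open>
  Finite simple graphs: an edge is the two-element set of its end vertices. Well-formedness is the
  predicate \<open>sgraph\<close>, so it has to be assumed (or built into a set of graphs) wherever
  ``graph'' is meant.
\<close>

record 'a graph =
  verts :: "'a set"
  edges :: "'a set set"

definition sgraph :: "'a graph \<Rightarrow> bool" where
  "sgraph G \<longleftrightarrow> finite (verts G) \<and> (\<forall>e\<in>edges G. e \<subseteq> verts G \<and> card e = 2)"

definition subgraph :: "'a graph \<Rightarrow> 'a graph \<Rightarrow> bool" where
  "subgraph H G \<longleftrightarrow> verts H \<subseteq> verts G \<and> edges H \<subseteq> edges G"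

definition clique :: "'a graph \<Rightarrow> 'a set \<Rightarrow> bool" where
  "clique G S \<longleftrightarrow> S \<subseteq> verts G \<and> (\<forall>u\<in>S. \<forall>v\<in>S. u \<noteq> v \<longrightarrow> {u, v} \<in> edges G)"

definition delete_verts :: "'a graph \<Rightarrow> 'a set \<Rightarrow> 'a graph" where
  "delete_verts G S = \<lparr>verts = verts G - S, edges = {e \<in> edges G. e \<inter> S = {}}\<rparr>"

definition connected_rel :: "'a graph \<Rightarrow> ('a \<times> 'a) set" where
  "connected_rel G =
     {(u, v). u \<in> verts G \<and> v \<in> verts G \<and> (u, v) \<in> {(x, y). {x, y} \<in> edges G}\<^sup>*}"

text \<open>The components of a graph are represented by their vertex sets.\<close>

definition components :: "'a graph \<Rightarrow> 'a set set" where
  "components G = verts G // connected_rel G"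

definition connected_graph :: "'a graph \<Rightarrow> bool" where
  "connected_graph G \<longleftrightarrow> verts G \<noteq> {} \<and> (\<forall>u\<in>verts G. \<forall>v\<in>verts G. (u, v) \<in> connected_rel G)"

definition perfect_matching :: "'a graph \<Rightarrow> 'a set set \<Rightarrow> bool" where
  "perfect_matching G M \<longleftrightarrow> M \<subseteq> edges G \<and> (\<forall>v\<in>verts G. \<exists>!e. e \<in> M \<and> v \<in> e)"

definition num_pm :: "'a graph \<Rightarrow> nat" (\<open>\<Phi>\<close>) where
  "\<Phi> G = card {M. perfect_matching G M}"

definition extendable :: "'a graph \<Rightarrow> 'a set \<Rightarrow> bool" where
  "extendable G e \<longleftrightarrow> (\<exists>M. perfect_matching G M \<and> e \<in> M)"

text \<open>
  Read literally, this makes the one-vertex graph 1-extendable, although it has no perfect matching.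
\<close>

definition one_extendable :: "'a graph \<Rightarrow> bool" where
  "one_extendable G \<longleftrightarrow> connected_graph G \<and> (\<forall>e\<in>edges G. extendable G e)"

definition odd_comps :: "'a graph \<Rightarrow> nat" where
  "odd_comps G = card {C \<in> components G. odd (card C)}"

definition barrier :: "'a graph \<Rightarrow> 'a set \<Rightarrow> bool" where
  "barrier G S \<longleftrightarrow> S \<subseteq> verts G \<and> odd_comps (delete_verts G S) = card S"

definition maximal_in :: "'b set \<Rightarrow> ('b \<Rightarrow> 'b \<Rightarrow> bool) \<Rightarrow> 'b \<Rightarrow> bool" where
  "maximal_in A le x \<longleftrightarrow> x \<in> A \<and> (\<forall>y\<in>A. le x y \<longrightarrow> y = x)"

definition max_barriers :: "'a graph \<Rightarrow> 'a set set" (\<open>\<P>\<close>) where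
  "\<P> G = {S. maximal_in {B. barrier G B} (\<subseteq>) S}"

definition extensions :: "'a graph \<Rightarrow> 'a graph set" (\<open>\<E>\<close>) where
  "\<E> H = {G. sgraph G \<and> subgraph H G \<and> verts G = verts H \<and> \<Phi> G = \<Phi> H}"

definition meets_two_comps :: "'a graph \<Rightarrow> 'a set \<Rightarrow> 'a set \<Rightarrow> bool" where
  "meets_two_comps H A B \<longleftrightarrow>
     (\<exists>C\<in>components (delete_verts H B). \<exists>D\<in>components (delete_verts H B).
        C \<noteq> D \<and> A \<inter> C \<noteq> {} \<and> A \<inter> D \<noteq> {})"

definition conflict :: "'a graph \<Rightarrow> 'a set \<Rightarrow> 'a set \<Rightarrow> bool" where
  "conflict H B\<^sub>1 B\<^sub>2 \<longleftrightarrow>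
     B\<^sub>1 \<inter> B\<^sub>2 \<noteq> {} \<or> meets_two_comps H B\<^sub>1 B\<^sub>2 \<or> meets_two_comps H B\<^sub>2 B\<^sub>1"

text \<open>
  \<open>partition_on\<close> requires nonempty blocks, so the empty barrier belongs to no cover set. This is
  what makes \<open>refines_cover\<close> antisymmetric on cover sets.
\<close>

definition cover_sets :: "'a graph \<Rightarrow> 'a set set set" (\<open>\<C>\<close>) where
  "\<C> H = {I. (\<forall>B\<in>I. barrier H B) \<and>
             (\<forall>B\<^sub>1\<in>I. \<forall>B\<^sub>2\<in>I. B\<^sub>1 \<noteq> B\<^sub>2 \<longrightarrow> \<not> conflict H B\<^sub>1 B\<^sub>2) \<and>
             partition_on (verts H) I}"

definition refines_cover :: "'a set set \<Rightarrow> 'a set set \<Rightarrow> bool" (infix \<open>\<preceq>\<close> 50) where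
  "I\<^sub>1 \<preceq> I\<^sub>2 \<longleftrightarrow> (\<forall>B\<^sub>1\<in>I\<^sub>1. \<exists>B\<^sub>2\<in>I\<^sub>2. B\<^sub>1 \<subseteq> B\<^sub>2)"

end

theory Submission
  imports Defs
begin

text \<open>
  A matching is encoded as an involution whose fixed points are the missed vertices, so that the
  components of the symmetric difference of two matchings become orbits of a dihedral group.

  Call \<open>u\<close> and \<open>v\<close> linked if \<open>G - u - v\<close> has a perfect matching. Since the extendable edges of \<open>G\<close> form
  the connected spanning subgraph \<open>H\<close>, being equal or not linked is an equivalence relation (Kotzig).
  For a class \<open>B\<close>, Gallai's argument applied to the maximum matchings of \<open>G - B\<close> shows that every
  component of \<open>G - B\<close> is odd and misses exactly one vertex, so \<open>B\<close> is a barrier; as the vertices of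
  a barrier are pairwise not linked, the classes are the maximal barriers. Edges of \<open>G\<close> outside \<open>H\<close>
  lie within classes, and \<open>G - B\<close> and \<open>H - B\<close> have the same components, so two maximal barriers that
  are cliques of \<open>G\<close> cannot conflict in \<open>H\<close>.

  If \<open>G\<close> is maximal, every class is a clique, because joining two vertices that are not linked creates
  no perfect matching. Conversely, filling the members of a cover set of \<open>H\<close> with edges yields an
  element of \<open>\<E> H\<close> in which they are barriers. This translates maximality in \<open>\<E> H\<close> into maximality
  in \<open>\<C> H\<close>.
\<close>

section \<open>Matchings as involutions\<close>

text \<open>\<open>F\<close> is exactly the set of missed vertices. The values of \<open>m\<close>
  outside \<open>verts G\<close> are left open, so several functions may encode the same
  matching.\<close>

definition matching_fun :: "'a graph \<Rightarrow> 'a set \<Rightarrow> ('a \<Rightarrow> 'a) \<Rightarrow> bool" where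
  "matching_fun G F m \<longleftrightarrow> F \<subseteq> verts G \<and>
     (\<forall>v\<in>verts G. m v \<in> verts G \<and> m (m v) = v \<and> (m v = v \<longleftrightarrow> v \<in> F) \<and>
        (v \<notin> F \<longrightarrow> {v, m v} \<in> edges G))"

lemma matching_funD:
  assumes "matching_fun G F m" and "v \<in> verts G"
  shows "m v \<in> verts G" "m (m v) = v" "m v = v \<longleftrightarrow> v \<in> F" "v \<notin> F \<Longrightarrow> {v, m v} \<in> edges G"
  using assms by (auto simp: matching_fun_def)

lemma matching_fun_image_notin:
  assumes "matching_fun G F m" and "v \<in> verts G" and "v \<notin> F"
  shows "m v \<notin> F" "m v \<noteq> v"
  using assms by (auto simp: matching_fun_def) metis

lemma matching_fun_add_edge:
  assumes "matching_fun G F m" and "u \<in> F" "v \<in> F" "u \<noteq> v" and "{u, v} \<in> edges G"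
  shows "matching_fun G (F - {u, v}) (m(u := v, v := u))"
proof -
  have "m w \<noteq> u" "m w \<noteq> v" if "w \<in> verts G" "w \<noteq> u" "w \<noteq> v" for w
    using assms that unfolding matching_fun_def by (metis subsetD)+
  with assms show ?thesis
    unfolding matching_fun_def by (auto simp: insert_commute)
qed

lemma matching_fun_del_edge:
  assumes "matching_fun G F m" and "u \<in> verts G"
  shows "matching_fun G (insert u (insert (m u) F)) (m(u := u, m u := m u))"
proof -
  have "m w \<noteq> u" "m w \<noteq> m u" if "w \<in> verts G" "w \<noteq> u" "w \<noteq> m u" for w
    using assms that unfolding matching_fun_def by metis+
  with assms show ?thesis
    unfolding matching_fun_def by auto
qed

text \<open>A matching of \<open>G - B\<close> is treated as a matching of \<open>G\<close> that
  misses all of \<open>B\<close>; clearing \<open>B\<close> also strands the partners of its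
  vertices.\<close>

lemma matching_fun_restrict:
  assumes "matching_fun G F m" and "B \<subseteq> verts G"
  shows "matching_fun G (F \<union> B \<union> m ` B) (\<lambda>v. if v \<in> B \<union> m ` B then v else m v)"
proof -
  have "m w \<notin> B \<union> m ` B" if "w \<in> verts G" "w \<notin> B" "w \<notin> m ` B" for w
    using assms that unfolding matching_fun_def by (metis Un_iff imageE image_eqI subsetD)
  with assms show ?thesis
    unfolding matching_fun_def by auto
qed

text \<open>Because \<open>m1\<close> is an involution, the complement of \<open>K\<close> is
  invariant under it as well, so the two matchings can be glued along \<open>K\<close>.\<close>

lemma matching_fun_swap:
  assumes "matching_fun G F1 m1" and "matching_fun G F2 m2" and "K \<subseteq> verts G"
    and "m1 ` K \<subseteq> K" and "m2 ` K \<subseteq> K"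
  shows "matching_fun G (F2 \<inter> K \<union> (F1 - K)) (\<lambda>v. if v \<in> K then m2 v else m1 v)"
proof -
  have "m1 w \<notin> K" if "w \<in> verts G" "w \<notin> K" for w
    using assms that unfolding matching_fun_def by (metis image_subset_iff)
  with assms show ?thesis
    unfolding matching_fun_def by auto
qed

text \<open>The orbit of \<open>t\<close> under the group generated by the involutions \<open>m1\<close> and \<open>m2\<close> consists of
  the points \<open>f\<^sup>n t\<close> with \<open>f = m2 \<circ> m1\<close> and \<open>n\<close> modulo the period \<open>p\<close>. Since \<open>m2\<close> fixes \<open>t\<close>, it acts
  as \<open>n \<mapsto> -n\<close>, and \<open>m1\<close> acts as \<open>n \<mapsto> -1 - n\<close>; together they have two fixed points modulo \<open>p\<close>.\<close>

lemma alternating_orbit: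
  assumes fin: "finite (verts G)" and m1: "matching_fun G F1 m1" and m2: "matching_fun G F2 m2"
    and t: "t \<in> F2"
  obtains K s where "K \<subseteq> verts G" "t \<in> K" "s \<in> K" "m1 ` K \<subseteq> K" "m2 ` K \<subseteq> K"
    "F1 \<inter> K = {s} \<and> F2 \<inter> K = {t} \<or> F1 \<inter> K = {} \<and> F2 \<inter> K = {t, s} \<and> s \<noteq> t"
proof -
  define f where "f = m2 \<circ> m1"
  define h where "h = m1 \<circ> m2"
  define a where "a n = (f ^^ n) t" for n
  have tV: "t \<in> verts G" using t m2 by (auto simp: matching_fun_def)
  have aS: "a (Suc n) = f (a n)" for n by (simp add: a_def)
  have fV: "f v \<in> verts G" if "v \<in> verts G" for v
    using that m1 m2 by (auto simp: f_def matching_fun_def)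
  have hf: "h (f v) = v" if "v \<in> verts G" for v
    using that m1 m2 by (auto simp: f_def h_def matching_fun_def)
  have aV: "a n \<in> verts G" for n
    by (induction n) (auto simp: aS fV tV a_def)
  \<comment> \<open>\<open>h\<close> undoes \<open>f\<close> on vertices, so its powers continue the
    orbit to negative indices.\<close>
  have hpow: "(h ^^ n) (a (n + k)) = a k" for n k
    by (induction n arbitrary: k) (auto simp: funpow_swap1 aS hf aV simp flip: add_Suc_right)
  have m2a: "m2 (a n) = (h ^^ n) t" for n
  proof (induction n)
    case 0
    then show ?case using t m2 tV by (auto simp: a_def matching_fun_def)
  next
    case (Suc n)
    have "m2 (a (Suc n)) = m1 (a n)"
      using m1 m2 aV[of n] by (auto simp: aS f_def matching_fun_def)
    also have "\<dots> = h (m2 (a n))"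
      using m2 aV[of n] by (auto simp: h_def matching_fun_def)
    finally show ?case using Suc by simp
  qed
  have m1a: "m1 (a n) = (h ^^ Suc n) t" for n
  proof -
    have "m1 (a n) = m2 (a (Suc n))"
      using m1 m2 aV[of n] by (auto simp: aS f_def matching_fun_def)
    then show ?thesis using m2a by simp
  qed
  \<comment> \<open>As \<open>f\<close> is injective on vertices, a repetition in the finite orbit
    leads back to \<open>t\<close> itself.\<close>
  have "\<not> inj a"
    using fin aV by (metis finite_imageD finite_subset image_subsetI infinite_UNIV_nat)
  then obtain i j where ij: "a i = a j" "i < j"
    by (metis injI linorder_neqE_nat)
  have "a (j - i) = t"
    using hpow[of i 0] hpow[of i "j - i"] ij by (simp add: a_def)
  then have "\<exists>q. 0 < q \<and> a q = t"
    using ij by (metis zero_less_diff)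
  define p where "p = (LEAST q. 0 < q \<and> a q = t)"
  have p: "0 < p" "a p = t"
    using LeastI_ex[OF \<open>\<exists>q. 0 < q \<and> a q = t\<close>] by (auto simp: p_def)
  have pmin: "a q \<noteq> t" if "0 < q" "q < p" for q
    using not_less_Least[of q "\<lambda>q. 0 < q \<and> a q = t"] that by (auto simp: p_def)
  have inj: "i = j" if "a i = a j" "i < p" "j < p" for i j
  proof -
    have *: False if "a i = a j" "i < j" "j < p" for i j
    proof -
      have "a (j - i) = t"
        using hpow[of i 0] hpow[of i "j - i"] that by (simp add: a_def)
      then show False using pmin[of "j - i"] that by auto
    qed
    show ?thesis using *[of i j] *[of j i] that by (metis linorder_neqE_nat)
  qed
  have hn: "(h ^^ n) t = a (p - n)" if "n \<le> p" for n
    using hpow[of n "p - n"] that p by simp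
  define K where "K = a ` {..<p}"
  have m1K: "m1 (a n) = a (p - 1 - n)" if "n < p" for n
    using hn[of "Suc n"] m1a[of n] that by simp
  have m2K: "m2 (a n) = (if n = 0 then a 0 else a (p - n))" if "n < p" for n
    using hn[of n] m2a[of n] that by (auto simp: a_def)
  have F1: "a n \<in> F1 \<longleftrightarrow> p = 2 * n + 1" if "n < p" for n
  proof -
    have "a n \<in> F1 \<longleftrightarrow> m1 (a n) = a n" using m1 aV by (auto simp: matching_fun_def)
    also have "\<dots> \<longleftrightarrow> p - 1 - n = n" using m1K that inj[of "p - 1 - n" n] by auto
    finally show ?thesis using that by auto
  qed
  have F2: "a n \<in> F2 \<longleftrightarrow> n = 0 \<or> p = 2 * n" if "n < p" for n
  proof -
    have "a n \<in> F2 \<longleftrightarrow> m2 (a n) = a n" using m2 aV by (auto simp: matching_fun_def)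
    also have "\<dots> \<longleftrightarrow> n = 0 \<or> p - n = n" using m2K that inj[of "p - n" n] by auto
    finally show ?thesis using that by auto
  qed
  have a0: "a 0 = t" by (simp add: a_def)
  have c1: "m1 ` K \<subseteq> K" using m1K by (auto simp: K_def)
  have c2: "m2 ` K \<subseteq> K" using m2K p(1) by (auto simp: K_def)
  have c3: "K \<subseteq> verts G" "t \<in> K" using aV p(1) a0 by (auto simp: K_def)
  show thesis
  \<comment> \<open>The reflection \<open>n \<mapsto> -n\<close> fixes 0 and, for even
    \<open>p\<close>, also \<open>p/2\<close>. The reflection \<open>n \<mapsto> -1 - n\<close> has
    a fixed point only for odd \<open>p\<close>, namely \<open>(p - 1)/2\<close>.\<close>
  proof (cases "even p")
    case True
    then obtain q where q: "p = 2 * q" by auto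
    then have "a q \<noteq> t" using pmin p(1) by auto
    moreover have "F1 \<inter> K = {}" using F1 q by (auto simp: K_def) presburger
    moreover have "F2 \<inter> K = {t, a q}" using F2[of q] F2[of 0] F2 q p(1) a0 by (auto simp: K_def)
    ultimately show thesis using that[of K "a q"] c1 c2 c3 by auto
  next
    case False
    then obtain q where q: "p = 2 * q + 1" by (auto elim: oddE)
    then have "F1 \<inter> K = {a q}" using F1[of q] F1 by (auto simp: K_def)
    moreover have "F2 \<inter> K = {t}" using F2[of 0] F2 q p(1) a0 by (auto simp: K_def) presburger
    ultimately show thesis using that[of K "a q"] c1 c2 c3 by auto
  qed
qed

lemma even_card_involution:
  assumes "finite D" and "\<And>v. v \<in> D \<Longrightarrow> m v \<in> D \<and> m (m v) = v \<and> m v \<noteq> v"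
  shows "even (card D)"
  using assms
proof (induction D rule: finite_psubset_induct)
  case (psubset D)
  show ?case
  proof (cases "D = {}")
    case False
    then obtain v where v: "v \<in> D" by auto
    have "even (card (D - {v, m v}))"
    proof (rule psubset.IH)
      show "D - {v, m v} \<subset> D" using v by auto
      show "m w \<in> D - {v, m v} \<and> m (m w) = w \<and> m w \<noteq> w" if "w \<in> D - {v, m v}" for w
        using that psubset.prems v by (metis Diff_iff insert_iff empty_iff)
    qed
    moreover have "card (D - {v, m v}) + 2 = card D"
    proof -
      have "card {v, m v} = 2" "{v, m v} \<subseteq> D" using psubset.prems[OF v] v by auto
      then show ?thesis using psubset.hyps
        by (metis card_Diff_subset card_mono finite_subset le_add_diff_inverse2)
    qed
    ultimately show ?thesis by (metis even_add even_numeral)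
  qed simp
qed

section \<open>Components and barriers\<close>

lemma connected_rel_subset: "connected_rel G \<subseteq> verts G \<times> verts G"
  by (auto simp: connected_rel_def)

lemma equiv_connected_rel: "equiv (verts G) (connected_rel G)"
proof (rule equivI)
  show "connected_rel G \<subseteq> verts G \<times> verts G" by (rule connected_rel_subset)
  show "refl_on (verts G) (connected_rel G)" by (auto simp: refl_on_def connected_rel_def)
  have "sym {(x, y). {x, y} \<in> edges G}" by (auto simp: sym_def insert_commute)
  then have "sym ({(x, y). {x, y} \<in> edges G}\<^sup>*)" by (rule sym_rtrancl)
  then show "sym (connected_rel G)" by (auto simp: sym_def connected_rel_def)
  show "trans (connected_rel G)"
    by (rule transI) (auto simp: connected_rel_def intro: rtrancl_trans)
qed

lemma connected_rel_trans:
  "(u, v) \<in> connected_rel G \<Longrightarrow> (v, w) \<in> connected_rel G \<Longrightarrow> (u, w) \<in> connected_rel G"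
  using equiv_connected_rel[of G] by (meson equivE transE)

lemma connected_rel_edge:
  "u \<in> verts G \<Longrightarrow> v \<in> verts G \<Longrightarrow> {u, v} \<in> edges G \<Longrightarrow> (u, v) \<in> connected_rel G"
  by (auto simp: connected_rel_def)

lemma sgraph_edgeD:
  assumes "sgraph G" and "{u, v} \<in> edges G"
  shows "u \<in> verts G" "v \<in> verts G" "u \<noteq> v"
  using assms by (auto simp: sgraph_def)

text \<open>\<open>connected_rel\<close> restricts only the two ends of a walk; well-formedness
  keeps the inner vertices in \<open>verts G\<close>.\<close>

lemma connected_rel_induct [consumes 2, case_names base step]:
  assumes "(u, v) \<in> connected_rel G" and "sgraph G" and "P u"
    and "\<And>x y. (u, x) \<in> connected_rel G \<Longrightarrow> {x, y} \<in> edges G \<Longrightarrow> P x \<Longrightarrow> P y"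
  shows "P v"
proof -
  have uv: "u \<in> verts G" "(u, v) \<in> {(x, y). {x, y} \<in> edges G}\<^sup>*"
    using assms(1) by (auto simp: connected_rel_def)
  from uv(2) have "P v \<and> v \<in> verts G"
  proof induction
    case base
    then show ?case using assms uv by auto
  next
    case (step y z)
    then show ?case using assms(2) assms(4)[of y z] uv
      by (auto simp: connected_rel_def dest: sgraph_edgeD)
  qed
  then show ?thesis by simp
qed

text \<open>The ends of an edge of \<open>G1\<close> need only be connected in \<open>G2\<close>,
  not adjacent. This allows added edges to be replaced by walks inside a component.\<close>

lemma connected_rel_mono:
  assumes "sgraph G1" and "verts G1 = verts G2"
    and "\<And>u v. {u, v} \<in> edges G1 \<Longrightarrow> (u, v) \<in> connected_rel G2"
  shows "connected_rel G1 \<subseteq> connected_rel G2"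
proof clarify
  fix u v assume uv: "(u, v) \<in> connected_rel G1"
  then have u: "u \<in> verts G2" using assms(2) connected_rel_subset by blast
  from uv assms(1) show "(u, v) \<in> connected_rel G2"
  proof (induction rule: connected_rel_induct)
    case base
    then show ?case using u by (auto simp: connected_rel_def)
  next
    case (step x y)
    then show ?case using assms(3) connected_rel_trans by metis
  qed
qed

lemma components_subset: "C \<in> components G \<Longrightarrow> C \<subseteq> verts G"
  unfolding components_def using equiv_connected_rel in_quotient_imp_subset by metis

lemma components_nonempty: "C \<in> components G \<Longrightarrow> C \<noteq> {}"
  unfolding components_def using equiv_connected_rel in_quotient_imp_non_empty by metis

lemma components_cover: "v \<in> verts G \<Longrightarrow> \<exists>C\<in>components G. v \<in> C"
  unfolding components_def using equiv_connected_rel Union_quotient by (metis UnionE)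

lemma components_eq: "C \<in> components G \<Longrightarrow> D \<in> components G \<Longrightarrow> v \<in> C \<Longrightarrow> v \<in> D \<Longrightarrow> C = D"
  unfolding components_def using equiv_connected_rel[of G] quotient_disj by fastforce

lemma components_connected: "C \<in> components G \<Longrightarrow> u \<in> C \<Longrightarrow> v \<in> C \<Longrightarrow> (u, v) \<in> connected_rel G"
  unfolding components_def using equiv_connected_rel[of G] in_quotient_imp_in_rel by fastforce

lemma components_closed:
  "C \<in> components G \<Longrightarrow> u \<in> C \<Longrightarrow> (u, v) \<in> connected_rel G \<Longrightarrow> v \<in> C"
  unfolding components_def using equiv_connected_rel[of G] in_quotient_imp_closed by fastforce

lemma verts_delete_verts [simp]: "verts (delete_verts G S) = verts G - S"
  by (simp add: delete_verts_def)

lemma edges_delete_verts [simp]: "edges (delete_verts G S) = {e \<in> edges G. e \<inter> S = {}}"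
  by (simp add: delete_verts_def)

lemma sgraph_delete_verts: "sgraph G \<Longrightarrow> sgraph (delete_verts G S)"
  by (auto simp: sgraph_def)

section \<open>Matchings and odd components\<close>

lemma matching_fun_component:
  assumes "matching_fun G F m" and "D \<in> components (delete_verts G S)" and "v \<in> D" and "m v \<notin> S"
  shows "m v \<in> D"
proof -
  have v: "v \<in> verts G" "v \<notin> S" using components_subset[OF assms(2)] assms(3) by auto
  show ?thesis
  proof (cases "v \<in> F")
    case True
    then show ?thesis using matching_funD(3)[OF assms(1) v(1)] assms(3) by simp
  next
    case False
    then have "(v, m v) \<in> connected_rel (delete_verts G S)"
      using matching_funD[OF assms(1) v(1)] v assms(4) by (intro connected_rel_edge) auto
    then show ?thesis using components_closed assms by metis
  qed
qed

text \<open>Otherwise \<open>m\<close> would be a fixed-point-free involution on \<open>D\<close>,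
  and \<open>D\<close> would have even size.\<close>

lemma odd_component_exit:
  assumes "sgraph G" and "matching_fun G F m" and "F \<subseteq> S" and "D \<in> components (delete_verts G S)"
    and "odd (card D)"
  shows "\<exists>v\<in>D. m v \<in> S - F"
proof -
  have D: "D \<subseteq> verts G - S" "finite D"
    using components_subset[OF assms(4)] assms(1) by (auto simp: sgraph_def intro: finite_subset)
  have "\<exists>v\<in>D. m v \<in> S"
  proof (rule ccontr)
    assume "\<not> (\<exists>v\<in>D. m v \<in> S)"
    then have "m v \<in> D \<and> m (m v) = v \<and> m v \<noteq> v" if "v \<in> D" for v
      using that matching_fun_component[OF assms(2,4) that] matching_funD[OF assms(2), of v] D assms(3)
      by auto
    with even_card_involution[of D m] D assms(5) show False by blast
  qed
  then show ?thesis
    using D assms(2,3) matching_fun_image_notin(1)[OF assms(2)] by blast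
qed

text \<open>One exit is chosen for each odd component. Components are disjoint and \<open>m\<close>
  is injective on vertices, so the exits lead to different vertices of \<open>S\<close>.\<close>

lemma odd_components_exits:
  assumes "sgraph G" and "matching_fun G F m" and "F \<subseteq> S"
  obtains c where "\<And>D. D \<in> components (delete_verts G S) \<Longrightarrow> odd (card D) \<Longrightarrow> c D \<in> D \<and> m (c D) \<in> S - F"
    and "inj_on (m \<circ> c) {D \<in> components (delete_verts G S). odd (card D)}"
proof -
  obtain c where c: "c D \<in> D \<and> m (c D) \<in> S - F"
    if "D \<in> components (delete_verts G S)" "odd (card D)" for D
    using odd_component_exit[OF assms] by metis
  have "inj_on (m \<circ> c) {D \<in> components (delete_verts G S). odd (card D)}"
  proof (rule inj_onI)
    fix D E assume DE: "D \<in> {D \<in> components (delete_verts G S). odd (card D)}"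
      "E \<in> {D \<in> components (delete_verts G S). odd (card D)}" "(m \<circ> c) D = (m \<circ> c) E"
    have "c D = c E"
      using DE c[of D] c[of E] components_subset[of D "delete_verts G S"]
        components_subset[of E "delete_verts G S"] matching_funD(2)[OF assms(2)]
      by (metis (no_types, lifting) DiffD1 comp_apply mem_Collect_eq subsetD verts_delete_verts)
    then show "D = E" using DE c components_eq by (metis (no_types, lifting) mem_Collect_eq)
  qed
  with c that show thesis by blast
qed

text \<open>The counting half of the Tutte-Berge formula, for missed vertices that all lie in
  \<open>S\<close>.\<close>

lemma odd_comps_le:
  assumes "sgraph G" and "matching_fun G F m" and "F \<subseteq> S" and "S \<subseteq> verts G"
  shows "odd_comps (delete_verts G S) \<le> card (S - F)"
proof -
  obtain c where "\<And>D. D \<in> components (delete_verts G S) \<Longrightarrow> odd (card D) \<Longrightarrow> c D \<in> D \<and> m (c D) \<in> S - F"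
    and "inj_on (m \<circ> c) {D \<in> components (delete_verts G S). odd (card D)}"
    using odd_components_exits[OF assms(1-3)] by blast
  then show ?thesis
    unfolding odd_comps_def using assms
    by (intro card_inj_on_le[of "m \<circ> c"]) (auto simp: sgraph_def intro: finite_subset)
qed

text \<open>Each vertex of a barrier is needed to serve an odd component, so none can be missed
  while everything outside is covered.\<close>

lemma barrier_no_near_matching:
  assumes "sgraph G" and "barrier G S" and "u \<in> S" "v \<in> S"
  shows "\<not> matching_fun G {u, v} m"
proof
  assume m: "matching_fun G {u, v} m"
  have S: "S \<subseteq> verts G" "finite S" "odd_comps (delete_verts G S) = card S"
    using assms by (auto simp: barrier_def sgraph_def intro: finite_subset)
  have "card S \<le> card (S - {u, v})" using odd_comps_le[OF assms(1) m, of S] assms S by simp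
  moreover have "card (S - {u, v}) < card S" using assms S by (intro psubset_card_mono) auto
  ultimately show False by simp
qed

lemma barrier_no_inner_edge:
  assumes "sgraph G" and "barrier G S" and "u \<in> S" "m u \<in> S"
  shows "\<not> matching_fun G {} m"
  using assms matching_fun_del_edge[of G "{}" m u] barrier_no_near_matching[OF assms]
  by (auto simp: barrier_def)

text \<open>By counting, the injection from odd components to \<open>S\<close> is onto. Every vertex
  of \<open>S\<close> is thus matched to a chosen exit, and a second exit of \<open>D\<close> would
  have no partner left.\<close>

lemma barrier_unique_exit:
  assumes "sgraph G" and "barrier G S" and m: "matching_fun G {} m"
    and D: "D \<in> components (delete_verts G S)" "odd (card D)"
    and v: "v \<in> D" "m v \<in> S" "w \<in> D" "m w \<in> S"
  shows "v = w"
proof -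
  let ?O = "{D \<in> components (delete_verts G S). odd (card D)}"
  have S: "S \<subseteq> verts G" "finite S" "card ?O = card S"
    using assms by (auto simp: barrier_def sgraph_def odd_comps_def intro: finite_subset)
  obtain c where c: "\<And>D. D \<in> components (delete_verts G S) \<Longrightarrow> odd (card D) \<Longrightarrow> c D \<in> D \<and> m (c D) \<in> S"
    and inj: "inj_on (m \<circ> c) ?O"
    using odd_components_exits[OF assms(1) m, of S] by auto
  have onto: "(m \<circ> c) ` ?O = S"
    using c S card_image[OF inj] by (intro card_subset_eq) (auto simp del: comp_apply simp add: comp_def)
  have *: "x = c D" if x: "x \<in> D" "m x \<in> S" for x
  proof -
    obtain E where E: "E \<in> ?O" "m x = m (c E)" using onto x by (metis (no_types, lifting) comp_apply imageE)
    have "c E \<in> E" "c E \<in> verts G" "x \<in> verts G"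
      using E c x components_subset[of E "delete_verts G S"] components_subset[OF D(1)] by auto
    then have "x = c E" using E matching_funD(2)[OF m] by metis
    then show ?thesis using E D x c components_eq by (metis (no_types, lifting) mem_Collect_eq)
  qed
  show ?thesis using *[of v] *[of w] v by simp
qed

section \<open>The canonical partition\<close>

text \<open>Bookkeeping for a swap along a path from \<open>c\<close> that ends in one of
  \<open>a\<close> and \<open>b\<close>: the other one stays missed.\<close>

lemma pair_swap_single:
  assumes "{a, b} \<inter> K = {s}" and "{c, d} \<inter> K = {c}" and "a \<noteq> b"
  shows "{c, d} \<inter> K \<union> ({a, b} - K) = {c, a} \<or> {c, d} \<inter> K \<union> ({a, b} - K) = {c, b}"
  unfolding assms(2) using assms(1,3)
  by (cases "a \<in> K"; cases "b \<in> K") (auto simp: Int_insert_left)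

definition linked :: "'a graph \<Rightarrow> 'a \<Rightarrow> 'a \<Rightarrow> bool" where
  "linked G u v \<longleftrightarrow> u \<noteq> v \<and> (\<exists>m. matching_fun G {u, v} m)"

lemma linkedI: "matching_fun G {u, v} m \<Longrightarrow> u \<noteq> v \<Longrightarrow> linked G u v"
  by (auto simp: linked_def)

lemma linked_sym: "linked G u v \<longleftrightarrow> linked G v u"
  by (auto simp: linked_def insert_commute)

text \<open>Swapping along the alternating path that starts in \<open>c\<close>: it ends in \<open>a\<close>, in \<open>b\<close> or in \<open>d\<close>.\<close>

lemma linked_or_near_matching:
  assumes fin: "finite (verts G)" and M: "matching_fun G {a, b} M" and N: "matching_fun G {c, d} N"
    and ne: "a \<noteq> b" "c \<noteq> a" "c \<noteq> b"
  shows "linked G c a \<or> linked G c b \<or> d \<noteq> a \<and> d \<noteq> b \<and> (\<exists>m. matching_fun G {a, b, c, d} m)"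
proof -
  obtain K s where K: "K \<subseteq> verts G" "c \<in> K" "s \<in> K" "M ` K \<subseteq> K" "N ` K \<subseteq> K"
    "{a, b} \<inter> K = {s} \<and> {c, d} \<inter> K = {c} \<or> {a, b} \<inter> K = {} \<and> {c, d} \<inter> K = {c, s} \<and> s \<noteq> c"
    using alternating_orbit[OF fin M N, of c] by auto
  note sw = matching_fun_swap[OF M N K(1,4,5)]
  from K(6) show ?thesis
  proof (elim disjE conjE)
    assume "{a, b} \<inter> K = {s}" "{c, d} \<inter> K = {c}"
    from pair_swap_single[OF this ne(1)] show ?thesis
    proof
      assume eq: "{c, d} \<inter> K \<union> ({a, b} - K) = {c, a}"
      show ?thesis using linkedI[OF sw[unfolded eq]] ne by simp
    next
      assume eq: "{c, d} \<inter> K \<union> ({a, b} - K) = {c, b}"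
      show ?thesis using linkedI[OF sw[unfolded eq]] ne by simp
    qed
  next
    assume *: "{a, b} \<inter> K = {}" "{c, d} \<inter> K = {c, s}" "s \<noteq> c"
    then have "d \<in> K" "s = d" by auto
    moreover have eq: "{c, d} \<inter> K \<union> ({a, b} - K) = {a, b, c, d}"
      unfolding *(2) \<open>s = d\<close> using *(1) by auto
    ultimately show ?thesis using *(1) sw[unfolded eq] by auto
  qed
qed

lemma matching_fun_mono:
  "matching_fun H F m \<Longrightarrow> verts G = verts H \<Longrightarrow> edges H \<subseteq> edges G \<Longrightarrow> matching_fun G F m"
  by (auto simp: matching_fun_def)

text \<open>Membership of \<open>G\<close> in \<open>\<E> H\<close> in terms of involutions:
  \<open>matching_H\<close> expresses that \<open>G\<close> has no perfect matching beyond those of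
  \<open>H\<close>. The assumption \<open>ex_matching\<close> rules out the one-vertex
  graph.\<close>

locale elementary_extension =
  fixes G H :: "'a graph"
  assumes sgraph_G: "sgraph G" and sgraph_H: "sgraph H"
    and verts_eq: "verts G = verts H" and edges_sub: "edges H \<subseteq> edges G"
    and matching_H: "\<And>m. matching_fun G {} m \<Longrightarrow> matching_fun H {} m"
    and ext: "\<And>u v. {u, v} \<in> edges H \<Longrightarrow> \<exists>m. matching_fun H {} m \<and> m u = v"
    and conn: "connected_graph H"
    and ex_matching: "\<exists>m. matching_fun H {} m"
begin

abbreviation "V \<equiv> verts G"

abbreviation "match F m \<equiv> matching_fun G F m"

lemma fin: "finite V"
  using sgraph_G by (simp add: sgraph_def)

lemma match_ext:
  assumes "{u, v} \<in> edges H"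
  obtains m where "match {} m" "m u = v"
  using ext[OF assms] matching_fun_mono verts_eq edges_sub by metis

lemma ex_match: obtains m where "match {} m"
  using ex_matching matching_fun_mono verts_eq edges_sub by metis

lemma edge_linked:
  assumes "{u, v} \<in> edges H"
  shows "linked G u v"
proof -
  obtain m where m: "match {} m" "m u = v" using match_ext assms .
  moreover have "u \<in> V" "u \<noteq> v"
    using assms sgraph_edgeD sgraph_H verts_eq by metis+
  ultimately show ?thesis using matching_fun_del_edge[of G "{}" m u] linkedI by fastforce
qed

lemma conn_induct [consumes 2, case_names base step]:
  assumes "u \<in> V" and "v \<in> V" and "P u" and "\<And>x y. {x, y} \<in> edges H \<Longrightarrow> P x \<Longrightarrow> P y"
  shows "P v"
proof -
  have "(u, v) \<in> connected_rel H" using conn assms verts_eq by (auto simp: connected_graph_def)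
  from this sgraph_H assms(3) show ?thesis
    by (induction rule: connected_rel_induct) (use assms(4) in auto)
qed

text \<open>Induction along a walk of \<open>H\<close> from \<open>y\<close>. By the invariant
  \<open>P\<close>, a vertex other than \<open>y\<close> that is not linked to \<open>y\<close> has
  only neighbours in \<open>H\<close> that are linked or equal to \<open>y\<close>.\<close>

lemma edge_linked_either:
  assumes y: "y \<in> V" and ab: "{a, b} \<in> edges H" and ne: "y \<noteq> a" "y \<noteq> b"
  shows "linked G y a \<or> linked G y b"
proof -
  define P where "P v \<longleftrightarrow> v = y \<or> linked G y v \<or> (\<forall>b. {v, b} \<in> edges H \<longrightarrow> linked G y b \<or> b = y)" for v
  have aV: "a \<in> V" using sgraph_edgeD[OF sgraph_H ab] verts_eq by simp
  from y aV have "P a"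
  proof (induction rule: conn_induct)
    case base
    then show ?case by (simp add: P_def)
  next
    case (step c v)
    have cv: "c \<in> V" "v \<in> V" "c \<noteq> v" using sgraph_edgeD[OF sgraph_H step(1)] verts_eq by auto
    have "linked G y b" if v: "v \<noteq> y" "\<not> linked G y v" and vb: "{v, b} \<in> edges H" "b \<noteq> y" for b
    proof (cases "b = c")
      case True
      then show ?thesis using step v edge_linked[of y v] by (auto simp: P_def)
    next
      case False
      have "c \<noteq> y" using step v edge_linked by auto
      \<comment> \<open>The hypothesis for \<open>c\<close> can only hold through
        \<open>linked G y c\<close>; its last alternative would link \<open>y\<close> to the
        neighbour \<open>v\<close>.\<close>
      then obtain N where N: "match {y, c} N"
        using step v by (auto simp: P_def linked_def)
      have bv: "b \<noteq> v" "b \<in> V" using sgraph_edgeD[OF sgraph_H vb(1)] verts_eq by auto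
      obtain M0 where M0: "match {} M0" "M0 v = b" using match_ext vb(1) .
      obtain M where M: "match {v, b} M"
        using matching_fun_del_edge[OF M0(1) cv(2)] M0(2) by auto
      have cvG: "{c, v} \<in> edges G" using step(1) edges_sub by auto
      have False if nl: "\<not> linked G y b"
      proof -
        \<comment> \<open>As \<open>y\<close> is linked to neither \<open>v\<close> nor
          \<open>b\<close>, the swap leaves all four vertices missed. Adding the edge
          \<open>{c, v}\<close> then links \<open>y\<close> and \<open>b\<close> after all.\<close>
        obtain m where "match {v, b, y, c} m"
          using linked_or_near_matching[OF fin M N] v vb nl bv by auto
        then have "\<exists>m. match ({v, b, y, c} - {c, v}) m"
          using matching_fun_add_edge[of G "{v, b, y, c}" m c v] cv cvG by auto
        moreover have "{v, b, y, c} - {c, v} = {y, b}"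
          using \<open>c \<noteq> y\<close> v bv False by auto
        ultimately show False using vb(2) nl by (auto simp: linked_def)
      qed
      then show ?thesis by auto
    qed
    then show ?case by (auto simp: P_def)
  qed
  then show ?thesis using ab ne by (auto simp: P_def)
qed

text \<open>Kotzig's transitivity, in contrapositive form. If \<open>y\<close> is not linked to
  \<open>x\<close>, it is linked to a partner \<open>x'\<close> of \<open>x\<close>; a swap either
  links \<open>y\<close> to \<open>x\<close> or \<open>z\<close>, or leaves \<open>x\<close>,
  \<open>z\<close>, \<open>y\<close>, \<open>x'\<close> missed, and then the edge
  \<open>{x, x'}\<close> can be added.\<close>

lemma linked_split:
  assumes xz: "linked G x z" and y: "y \<in> V"
  shows "linked G x y \<or> linked G y z"
proof (cases "y = x \<or> y = z")
  case True
  then show ?thesis using xz by auto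
next
  case ne: False
  obtain N where N: "match {x, z} N" and "x \<noteq> z" using xz by (auto simp: linked_def)
  obtain M where M: "match {} M" using ex_match .
  define x' where "x' = M x"
  have x: "x \<in> V" using N by (auto simp: matching_fun_def)
  have "matching_fun H {} M" using M by (rule matching_H)
  then have xx': "{x, x'} \<in> edges H" using matching_funD(4)[of H "{}" M x] x verts_eq by (simp add: x'_def)
  then have xG: "{x', x} \<in> edges G" "x \<noteq> x'" using edges_sub sgraph_edgeD[OF sgraph_H]
    by (auto simp: insert_commute)
  show ?thesis
  proof (rule ccontr)
    assume nl: "\<not> ?thesis"
    then have "y \<noteq> x'" using edge_linked[OF xx'] by auto
    then have lyx: "linked G y x'"
      using edge_linked_either[OF y xx'] ne nl linked_sym[of G x y] by auto
    then have "x' \<noteq> z" using nl by auto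
    from lyx obtain N' where N': "match {y, x'} N'" by (auto simp: linked_def)
    have nl': "\<not> linked G y x" "\<not> linked G y z" using nl linked_sym[of G x y] by auto
    then obtain m where m: "match {x, z, y, x'} m"
      using linked_or_near_matching[OF fin N N'] \<open>x \<noteq> z\<close> ne by auto
    have "\<exists>m. match ({x, z, y, x'} - {x', x}) m"
      using matching_fun_add_edge[OF m, of x' x] xG by auto
    moreover have "{x, z, y, x'} - {x', x} = {y, z}"
      using ne \<open>y \<noteq> x'\<close> \<open>x' \<noteq> z\<close> \<open>x \<noteq> z\<close> by auto
    ultimately show False using nl' ne by (auto simp: linked_def)
  qed
qed

definition cls :: "'a \<Rightarrow> 'a set" where
  "cls x = {v \<in> V. \<not> linked G x v}"

lemma cls_subset: "cls x \<subseteq> V"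
  by (auto simp: cls_def)

lemma cls_self: "x \<in> V \<Longrightarrow> x \<in> cls x"
  by (auto simp: cls_def linked_def)

lemma cls_inner: "x \<in> V \<Longrightarrow> u \<in> cls x \<Longrightarrow> v \<in> cls x \<Longrightarrow> \<not> linked G u v"
  unfolding cls_def using linked_split[of u v x] linked_sym[of G u x] by blast

lemma cls_outer: "x \<in> V \<Longrightarrow> u \<in> cls x \<Longrightarrow> v \<in> V \<Longrightarrow> v \<notin> cls x \<Longrightarrow> linked G u v"
  unfolding cls_def using linked_split[of x v u] by blast

lemma cls_eq: "x \<in> V \<Longrightarrow> y \<in> cls x \<Longrightarrow> cls y = cls x"
  using cls_inner[of x y] cls_outer[of x y] by (auto simp: cls_def)

section \<open>Gallai's argument for a fixed class\<close>

context
  fixes x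
  assumes x: "x \<in> V"
begin

lemma finite_cls: "finite (cls x)"
  using cls_subset fin finite_subset by blast

text \<open>A missed vertex of the class is joined by an alternating path, relative to a perfect matching,
  to a missed vertex, which lies outside the class; swap along this path and induct.\<close>

lemma card_missed_cls_le:
  assumes "match F N"
  shows "card (F \<inter> cls x) \<le> card (F - cls x)"
proof -
  have "finite F" using assms fin finite_subset by (auto simp: matching_fun_def)
  then show ?thesis using assms
  proof (induction F arbitrary: N rule: finite_psubset_induct)
    case (psubset F)
    show ?case
    proof (cases "F \<inter> cls x = {}")
      case True
      then show ?thesis by simp
    next
      case False
      then obtain b where b: "b \<in> F" "b \<in> cls x" by auto
      obtain M where M: "match {} M" using ex_match .
      obtain K s where K: "K \<subseteq> V" "b \<in> K" "s \<in> K" "M ` K \<subseteq> K" "N ` K \<subseteq> K"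
        and Fs: "F \<inter> K = {b, s} \<and> s \<noteq> b"
        using alternating_orbit[OF fin M psubset.prems b(1)] by auto
      \<comment> \<open>The orbit serves twice: a swap in \<open>M\<close> links \<open>b\<close>
        and \<open>s\<close>, a swap in \<open>N\<close> covers both.\<close>
      have "linked G b s"
        using linkedI[of G b s] matching_fun_swap[OF M psubset.prems K(1,4,5)] Fs by auto
      then have s: "s \<in> F" "s \<notin> cls x" using cls_inner[OF x b(2)] Fs by auto
      have "F - K = F - {b, s}" using Fs by auto
      then have "match (F - {b, s}) (\<lambda>v. if v \<in> K then M v else N v)"
        using matching_fun_swap[OF psubset.prems M K(1,5,4)] by simp
      then have "card ((F - {b, s}) \<inter> cls x) \<le> card (F - {b, s} - cls x)"
        using psubset.IH[of "F - {b, s}"] b by blast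
      moreover have "F \<inter> cls x = insert b ((F - {b, s}) \<inter> cls x)" "F - cls x = insert s (F - {b, s} - cls x)"
        using b s by auto
      ultimately show ?thesis using psubset.hyps by simp
    qed
  qed
qed

text \<open>These are the maximum matchings of \<open>G - cls x\<close>: by
  \<open>card_missed_cls_le\<close>, no matching that misses the class can miss fewer than
  \<open>card (cls x)\<close> vertices outside it.\<close>

definition opt :: "'a set \<Rightarrow> ('a \<Rightarrow> 'a) \<Rightarrow> bool" where
  "opt F N \<longleftrightarrow> match F N \<and> cls x \<subseteq> F \<and> card (F - cls x) = card (cls x)"

lemma optI:
  assumes "match F N" and "cls x \<subseteq> F" and "card (F - cls x) \<le> card (cls x)"
  shows "opt F N"
proof -
  have "F \<inter> cls x = cls x" using assms(2) by auto
  then show ?thesis using card_missed_cls_le[OF assms(1)] assms by (simp add: opt_def)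
qed

lemma opt_le: "opt F N \<Longrightarrow> match F' N' \<Longrightarrow> cls x \<subseteq> F' \<Longrightarrow> card (F - cls x) \<le> card (F' - cls x)"
  using card_missed_cls_le[of F' N'] by (simp add: opt_def Int_absorb1)

text \<open>Clearing the class out of a perfect matching strands at most one partner per class
  vertex.\<close>

lemma ex_opt: "\<exists>F N. opt F N"
proof -
  obtain M where M: "match {} M" using ex_match .
  have "card (({} \<union> cls x \<union> M ` cls x) - cls x) \<le> card (M ` cls x)"
    using finite_cls by (intro card_mono) auto
  also have "\<dots> \<le> card (cls x)" using finite_cls by (rule card_image_le)
  finally show ?thesis using optI[OF matching_fun_restrict[OF M cls_subset]] by blast
qed

text \<open>In a matching that misses \<open>x\<close> and \<open>d\<close>, the vertex
  \<open>x\<close> has no partner to strand, and this saving pays for \<open>d\<close>. The result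
  is the hypothesis of Gallai's lemma for the components of \<open>G - cls x\<close>.\<close>

lemma ex_opt_missing:
  assumes d: "d \<in> V" "d \<notin> cls x"
  shows "\<exists>F N. opt F N \<and> d \<in> F"
proof -
  have "linked G x d" using d by (simp add: cls_def)
  then obtain N where N: "match {x, d} N" by (auto simp: linked_def)
  have Nx: "N x = x" using matching_funD(3)[OF N x] by simp
  have xB: "x \<in> cls x" using cls_self x by simp
  let ?F = "{x, d} \<union> cls x \<union> N ` cls x"
  have "?F - cls x \<subseteq> insert d (N ` (cls x - {x}))" using Nx xB by auto
  then have "card (?F - cls x) \<le> card (insert d (N ` (cls x - {x})))"
    using finite_cls by (intro card_mono) auto
  also have "\<dots> \<le> Suc (card (N ` (cls x - {x})))"
    by (rule card_insert_le_m1) auto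
  also have "\<dots> \<le> Suc (card (cls x - {x}))"
    using finite_cls by (simp add: card_image_le)
  also have "\<dots> = card (cls x)"
    using finite_cls xB by (rule card_Suc_Diff1)
  finally show ?thesis using optI[OF matching_fun_restrict[OF N cls_subset]] by blast
qed

lemma opt_not_adjacent:
  assumes F: "opt F N" and uv: "u \<in> F - cls x" "v \<in> F - cls x" "u \<noteq> v"
  shows "{u, v} \<notin> edges G"
proof
  assume "{u, v} \<in> edges G"
  then have "match (F - {u, v}) (N(u := v, v := u))"
    using matching_fun_add_edge[of G F N u v] F uv by (auto simp: opt_def)
  then have "card (F - cls x) \<le> card (F - {u, v} - cls x)"
    using opt_le[OF F] F uv by (auto simp: opt_def)
  moreover have "finite F" using F fin finite_subset by (auto simp: opt_def matching_fun_def)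
  then have "card (F - {u, v} - cls x) < card (F - cls x)"
    using uv by (intro psubset_card_mono) auto
  ultimately show False by simp
qed

text \<open>Transitivity step in the proof of Gallai's lemma.\<close>

lemma opt_exchange:
  assumes F: "opt F N" and uv: "u \<in> F - cls x" "v \<in> F - cls x" "u \<noteq> v" and t: "t \<in> V" "t \<notin> cls x"
  shows "\<exists>F N. opt F N \<and> t \<in> F \<and> (u \<in> F \<or> v \<in> F)"
proof (cases "t \<in> F")
  case True
  then show ?thesis using F uv by auto
next
  case False
  obtain F' N' where F': "opt F' N'" "t \<in> F'" using ex_opt_missing t by blast
  have N: "match F N" "cls x \<subseteq> F" "card (F - cls x) = card (cls x)"
    and N': "match F' N'" "cls x \<subseteq> F'" "card (F' - cls x) = card (cls x)"
    using F F' by (auto simp: opt_def)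
  have finF: "finite F" "finite F'" using N N' fin finite_subset by (auto simp: matching_fun_def)
  obtain K s where K: "K \<subseteq> V" "t \<in> K" "s \<in> K" "N ` K \<subseteq> K" "N' ` K \<subseteq> K"
    "F \<inter> K = {s} \<and> F' \<inter> K = {t} \<or> F \<inter> K = {} \<and> F' \<inter> K = {t, s} \<and> s \<noteq> t"
    using alternating_orbit[OF fin N(1) N'(1) F'(2)] by auto
  from K(6) show ?thesis
  proof (elim disjE conjE)
    \<comment> \<open>The swap trades \<open>s\<close> for \<open>t\<close> among the missed
      vertices, so at most one of \<open>u\<close> and \<open>v\<close> is lost.\<close>
    assume *: "F \<inter> K = {s}" "F' \<inter> K = {t}"
    have "s \<in> F" using *(1) by auto
    have "s \<notin> cls x" using *(2) K(3) N'(2) t(2) by auto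
    have eq: "F' \<inter> K \<union> (F - K) = insert t (F - {s})" using * by auto
    have "match (insert t (F - {s})) (\<lambda>v. if v \<in> K then N' v else N v)"
      using matching_fun_swap[OF N(1) N'(1) K(1,4,5)] unfolding eq .
    moreover have "cls x \<subseteq> insert t (F - {s})" using N(2) \<open>s \<notin> cls x\<close> by auto
    moreover have "insert t (F - {s}) - cls x = insert t (F - cls x - {s})" using t(2) by auto
    then have "card (insert t (F - {s}) - cls x) \<le> card (cls x)"
      using finF False \<open>s \<in> F\<close> \<open>s \<notin> cls x\<close> N(3) card_Suc_Diff1[of "F - cls x" s] by simp
    ultimately have "opt (insert t (F - {s})) (\<lambda>v. if v \<in> K then N' v else N v)"
      by (rule optI)
    moreover have "u \<in> insert t (F - {s}) \<or> v \<in> insert t (F - {s})" using uv by auto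
    ultimately show ?thesis by blast
  next
    \<comment> \<open>Here the swap would cover both \<open>t\<close> and \<open>s\<close> in
      \<open>N'\<close>, which is already a maximum matching.\<close>
    assume *: "F \<inter> K = {}" "F' \<inter> K = {t, s}" "s \<noteq> t"
    have "s \<notin> cls x" using *(1) K(3) N(2) by auto
    have eq: "F \<inter> K \<union> (F' - K) = F' - {t, s}" using * by auto
    have "match (F' - {t, s}) (\<lambda>v. if v \<in> K then N v else N' v)"
      using matching_fun_swap[OF N'(1) N(1) K(1,5,4)] unfolding eq .
    moreover have "cls x \<subseteq> F' - {t, s}" using N'(2) \<open>s \<notin> cls x\<close> t(2) by auto
    ultimately have "card (F' - cls x) \<le> card (F' - {t, s} - cls x)" using opt_le[OF F'(1)] by blast
    moreover have "card (F' - {t, s} - cls x) < card (F' - cls x)"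
      using finF F'(2) t(2) by (intro psubset_card_mono) auto
    ultimately show ?thesis by simp
  qed
qed

text \<open>Gallai's lemma, by induction along a walk from \<open>u\<close>. If \<open>u\<close> and
  \<open>z\<close> are both missed and \<open>y\<close> precedes \<open>z\<close>, an exchange makes
  \<open>y\<close> missed together with \<open>u\<close> or \<open>z\<close>; the induction
  hypothesis excludes the former, adjacency the latter.\<close>

lemma component_missed_unique:
  assumes D: "D \<in> components (delete_verts G (cls x))" and F: "opt F N"
    and uv: "u \<in> D" "v \<in> D" "u \<in> F" "v \<in> F"
  shows "u = v"
proof -
  have u: "u \<in> V" "u \<notin> cls x" using components_subset[OF D] uv by auto
  have "(u, v) \<in> connected_rel (delete_verts G (cls x))"
    using components_connected D uv by metis
  then have "v = u \<or> \<not> (\<exists>F N. opt F N \<and> u \<in> F \<and> v \<in> F)"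
    using sgraph_delete_verts[OF sgraph_G]
  proof (induction rule: connected_rel_induct)
    case base
    then show ?case by simp
  next
    case (step y z)
    have yz: "{y, z} \<in> edges G" "y \<notin> cls x" "z \<notin> cls x" "y \<in> V" "z \<in> V" "y \<noteq> z"
      using step(2) sgraph_edgeD[OF sgraph_G] by auto
    show ?case
    proof (rule ccontr)
      assume "\<not> ?thesis"
      then obtain F N where F: "opt F N" "u \<in> F" "z \<in> F" "z \<noteq> u" by auto
      have "y \<noteq> u" using opt_not_adjacent[OF F(1), of y z] F yz by auto
      have "\<exists>F N. opt F N \<and> y \<in> F \<and> (u \<in> F \<or> z \<in> F)"
        using opt_exchange[OF F(1), of u z y] F yz u by auto
      then show False
        using step(3) \<open>y \<noteq> u\<close> opt_not_adjacent[of _ _ y z] yz by blast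
    qed
  qed
  then show ?thesis using F uv by auto
qed

lemma opt_component:
  assumes "opt F N" and "D \<in> components (delete_verts G (cls x))" and "v \<in> D" and "v \<notin> F"
  shows "N v \<in> D \<and> N (N v) = v \<and> N v \<noteq> v \<and> N v \<notin> F"
proof -
  have v: "v \<in> V" using components_subset[OF assms(2)] assms(3) by auto
  have N: "match F N" "cls x \<subseteq> F" using assms by (auto simp: opt_def)
  show ?thesis
    using matching_fun_image_notin[OF N(1) v assms(4)] matching_funD[OF N(1) v]
      matching_fun_component[OF N(1) assms(2,3)] N(2) by auto
qed

text \<open>A maximum matching that misses some \<open>d\<close> in \<open>D\<close> misses nothing
  else in \<open>D\<close>, so it pairs up the rest.\<close>

lemma odd_component:
  assumes D: "D \<in> components (delete_verts G (cls x))"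
  shows "odd (card D)"
proof -
  obtain d where d: "d \<in> D" using components_nonempty[OF D] by auto
  have DV: "D \<subseteq> V - cls x" "finite D"
    using components_subset[OF D] fin finite_subset by (auto intro: finite_subset)
  then obtain F N where F: "opt F N" "d \<in> F" using ex_opt_missing d by blast
  have "even (card (D - {d}))"
  proof (rule even_card_involution)
    fix v assume v: "v \<in> D - {d}"
    then have "v \<notin> F" using component_missed_unique[OF D F(1)] d F(2) by auto
    then show "N v \<in> D - {d} \<and> N (N v) = v \<and> N v \<noteq> v"
      using opt_component[OF F(1) D] v F(2) by auto
  qed (use DV in auto)
  then show ?thesis using d DV card_Suc_Diff1[of D d] by (metis even_Suc)
qed

text \<open>The vertices outside the class missed by a maximum matching correspond to the
  components: at most one in each by Gallai's lemma, at least one by parity.\<close>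

lemma barrier_cls: "barrier G (cls x)"
proof -
  let ?C = "components (delete_verts G (cls x))"
  obtain F N where F: "opt F N" using ex_opt by blast
  have FV: "F \<subseteq> V" using F by (auto simp: opt_def matching_fun_def)
  then have "\<forall>v\<in>F - cls x. \<exists>D\<in>?C. v \<in> D"
    using components_cover[of _ "delete_verts G (cls x)"] by auto
  then obtain f where f: "f v \<in> ?C" "v \<in> f v" if "v \<in> F - cls x" for v
    by metis
  have "bij_betw f (F - cls x) ?C"
  proof (rule bij_betw_imageI)
    show "inj_on f (F - cls x)"
      by (rule inj_onI) (metis component_missed_unique[OF _ F] f Diff_iff)
    show "f ` (F - cls x) = ?C"
    proof
      show "?C \<subseteq> f ` (F - cls x)"
      proof
        fix D assume D: "D \<in> ?C"
        have "\<exists>v\<in>D. v \<in> F"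
        proof (rule ccontr)
          assume "\<not> ?thesis"
          then have "even (card D)"
            using opt_component[OF F D] components_subset[OF D] fin
            by (intro even_card_involution[of D N]) (auto intro: finite_subset)
          then show False using odd_component[OF D] by simp
        qed
        then obtain v where v: "v \<in> D" "v \<in> F - cls x" using components_subset[OF D] by auto
        then have "f v = D" using f D components_eq by metis
        then show "D \<in> f ` (F - cls x)" using v by auto
      qed
    qed (use f in auto)
  qed
  then have "card ?C = card (cls x)" using F bij_betw_same_card by (metis opt_def)
  moreover have "{D \<in> ?C. odd (card D)} = ?C" using odd_component by auto
  ultimately show ?thesis using cls_subset by (simp add: barrier_def odd_comps_def)
qed

end

section \<open>Classes as maximal barriers\<close>

lemma verts_nonempty: "V \<noteq> {}"
  using conn verts_eq by (auto simp: connected_graph_def)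

lemma barrier_subset_cls:
  assumes "barrier G S" and "x \<in> S"
  shows "S \<subseteq> cls x"
proof
  fix v assume "v \<in> S"
  then show "v \<in> cls x"
    using barrier_no_near_matching[OF sgraph_G assms] assms
    by (auto simp: cls_def linked_def barrier_def)
qed

lemma max_barriers_eq: "\<P> G = cls ` V"
proof (intro equalityI subsetI)
  fix S assume "S \<in> \<P> G"
  then have S: "barrier G S" "\<And>S'. barrier G S' \<Longrightarrow> S \<subseteq> S' \<Longrightarrow> S' = S"
    by (auto simp: max_barriers_def maximal_in_def)
  show "S \<in> cls ` V"
  proof (cases "S = {}")
    \<comment> \<open>The empty set is not maximal, because it is contained in a nonempty
      class.\<close>
    case True
    then show ?thesis using S(2) barrier_cls cls_self verts_nonempty by blast
  next
    case False
    then obtain x where x: "x \<in> S" by auto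
    then have "x \<in> V" using S(1) by (auto simp: barrier_def)
    then show ?thesis using S(2)[OF barrier_cls barrier_subset_cls[OF S(1) x]] by auto
  qed
next
  fix S assume "S \<in> cls ` V"
  then obtain x where x: "x \<in> V" "S = cls x" by auto
  have "S' = S" if "barrier G S'" "S \<subseteq> S'" for S'
    using barrier_subset_cls[OF that(1), of x] that(2) x cls_self by auto
  then show "S \<in> \<P> G" using x barrier_cls by (auto simp: max_barriers_def maximal_in_def)
qed

lemma partition_cls: "partition_on V (cls ` V)"
proof (rule partition_onI)
  show "\<Union> (cls ` V) = V" using cls_subset cls_self by blast
  show "disjnt p q" if "p \<in> cls ` V" "q \<in> cls ` V" "p \<noteq> q" for p q
    using that cls_eq unfolding disjnt_def by blast
  show "{} \<notin> cls ` V" using cls_self by blast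
qed

section \<open>Comparison of the components of \<open>H - S\<close> and \<open>G - S\<close>\<close>

lemma component_exit_edge:
  assumes S: "S \<noteq> {}" "S \<subseteq> V" and C: "C \<in> components (delete_verts H S)"
  obtains c y where "c \<in> C" "y \<in> S" "{c, y} \<in> edges H"
proof -
  have "\<exists>c\<in>C. \<exists>y\<in>S. {c, y} \<in> edges H"
  proof (rule ccontr)
    assume no: "\<not> ?thesis"
    obtain c where c: "c \<in> C" using components_nonempty[OF C] by auto
    obtain y where y: "y \<in> S" using S by auto
    have sub: "C \<subseteq> V - S" using components_subset[OF C] verts_eq by auto
    have "c \<in> V" "y \<in> V" using c y sub S by auto
    \<comment> \<open>Without an edge from \<open>C\<close> to \<open>S\<close>, the set
      \<open>C\<close> is closed under adjacency in \<open>H\<close>, so connectivity puts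
      \<open>y\<close> into it.\<close>
    then have "y \<in> C"
    proof (induction rule: conn_induct)
      case base
      then show ?case by (rule c)
    next
      case (step v w)
      have vw: "v \<in> verts H" "w \<in> verts H" using sgraph_edgeD[OF sgraph_H step(1)] by auto
      have "w \<notin> S" "v \<notin> S" using no step sub by auto
      then have "(v, w) \<in> connected_rel (delete_verts H S)"
        using step(1) vw by (intro connected_rel_edge) auto
      then show ?case using components_closed C step(2) by metis
    qed
    then show False using y sub by auto
  qed
  then show thesis using that by blast
qed

lemma connected_rel_sub: "connected_rel (delete_verts H S) \<subseteq> connected_rel (delete_verts G S)"
proof (rule connected_rel_mono)
  fix u v assume "{u, v} \<in> edges (delete_verts H S)"
  then show "(u, v) \<in> connected_rel (delete_verts G S)"
    using edges_sub verts_eq sgraph_edgeD[OF sgraph_H] by (intro connected_rel_edge) auto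
qed (use verts_eq sgraph_delete_verts sgraph_H in auto)

text \<open>A perfect matching leaves the odd component \<open>K\<close> of \<open>G - S\<close> through one edge only. If this edge
  leaves from \<open>C\<close>, then \<open>D\<close> is even; if it leaves from \<open>D\<close>, then \<open>D\<close> is odd. Both can be arranged.\<close>

lemma barrier_components_H:
  assumes S: "barrier G S" "S \<noteq> {}" and K: "K \<in> components (delete_verts G S)" "odd (card K)"
    and C: "C \<in> components (delete_verts H S)" "C \<subseteq> K"
    and D: "D \<in> components (delete_verts H S)" "D \<subseteq> K"
  shows "C = D"
proof (rule ccontr)
  assume "C \<noteq> D"
  then have disj: "C \<inter> D = {}" using components_eq[OF C(1) D(1)] by auto
  have SV: "S \<subseteq> V" using S by (simp add: barrier_def)
  have DV: "D \<subseteq> V - S" "finite D"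
    using components_subset[OF D(1)] verts_eq fin by (auto intro: finite_subset)
  obtain c y where c: "c \<in> C" "y \<in> S" "{c, y} \<in> edges H"
    using component_exit_edge S(2) SV C(1) .
  obtain m where m: "match {} m" "m c = y" using match_ext c(3) .
  \<comment> \<open>A perfect matching of \<open>G\<close> uses only edges of \<open>H\<close>, so
    it cannot join different components of \<open>H - S\<close> inside \<open>K\<close>.\<close>
  have stay: "n v \<in> D \<and> n (n v) = v \<and> n v \<noteq> v" if "match {} n" "v \<in> D" "n v \<notin> S" for n v
    using that matching_fun_component[OF matching_H[OF that(1)] D(1)]
      matching_funD[OF that(1), of v] DV by auto
  have "m v \<notin> S" if "v \<in> D" for v
    using barrier_unique_exit[OF sgraph_G S(1) m(1) K, of v c] that c m(2) C D disj by auto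
  then have "even (card D)"
    using even_card_involution[of D m] stay[OF m(1)] DV by blast
  obtain d z where d: "d \<in> D" "z \<in> S" "{d, z} \<in> edges H"
    using component_exit_edge S(2) SV D(1) .
  obtain n where n: "match {} n" "n d = z" using match_ext d(3) .
  have "n v \<in> D - {d} \<and> n (n v) = v \<and> n v \<noteq> v" if v: "v \<in> D - {d}" for v
  proof -
    have "n v \<notin> S"
      using barrier_unique_exit[OF sgraph_G S(1) n(1) K, of v d] v d n(2) D by auto
    then have *: "n v \<in> D \<and> n (n v) = v \<and> n v \<noteq> v" using stay[OF n(1)] v by blast
    moreover have "n v \<noteq> d" using * v d n(2) DV by auto
    ultimately show ?thesis by blast
  qed
  then have "even (card (D - {d}))"
    using even_card_involution[of "D - {d}" n] DV by blast
  then show False using \<open>even (card D)\<close> d(1) DV card_Suc_Diff1[of D d] by (metis even_Suc)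
qed

text \<open>An edge of \<open>G\<close> outside the class lies in an odd component of
  \<open>G - cls x\<close>, and such a component contains only one component of
  \<open>H - cls x\<close>.\<close>

lemma components_cls:
  assumes x: "x \<in> V"
  shows "components (delete_verts H (cls x)) = components (delete_verts G (cls x))"
proof -
  let ?H = "delete_verts H (cls x)" and ?G = "delete_verts G (cls x)"
  have "connected_rel ?G \<subseteq> connected_rel ?H"
  proof (rule connected_rel_mono)
    fix u v assume uv: "{u, v} \<in> edges ?G"
    have uvV: "u \<in> verts ?G" "v \<in> verts ?G"
      using uv sgraph_edgeD[OF sgraph_G, of u v] by auto
    obtain K where K: "K \<in> components ?G" "u \<in> K" using components_cover uvV(1) by metis
    have "v \<in> K" using components_closed[OF K] connected_rel_edge[OF uvV uv] by blast
    obtain C D where C: "C \<in> components ?H" "u \<in> C" and D: "D \<in> components ?H" "v \<in> D"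
      using components_cover[of u ?H] components_cover[of v ?H] uvV verts_eq by auto
    have sub: "E \<subseteq> K" if "E \<in> components ?H" "w \<in> E" "w \<in> K" for E w
      using components_connected[OF that(1,2)] connected_rel_sub components_closed[OF K(1) that(3)]
      by blast
    have "cls x \<noteq> {}" using cls_self x by auto
    then have "C = D"
      using barrier_components_H[OF barrier_cls[OF x] _ K(1) odd_component[OF x K(1)] C(1) _ D(1)]
        sub C D K(2) \<open>v \<in> K\<close> by blast
    then show "(u, v) \<in> connected_rel ?H" using components_connected C D by metis
  qed (use sgraph_delete_verts sgraph_G verts_eq in auto)
  then have "connected_rel ?G = connected_rel ?H" using connected_rel_sub by blast
  then show ?thesis using verts_eq by (simp add: components_def)
qed

lemma barrier_H_cls: "x \<in> V \<Longrightarrow> barrier H (cls x)"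
  using barrier_cls components_cls verts_eq by (simp add: barrier_def odd_comps_def)

text \<open>If \<open>u\<close> and \<open>v\<close> were linked, the edge would complete a perfect
  matching of \<open>G\<close> that is not one of \<open>H\<close>.\<close>

lemma edge_not_H_cls:
  assumes "{u, v} \<in> edges G" and "{u, v} \<notin> edges H"
  shows "v \<in> cls u"
proof (rule ccontr)
  have uv: "u \<in> V" "v \<in> V" "u \<noteq> v" using sgraph_edgeD[OF sgraph_G assms(1)] by auto
  assume "v \<notin> cls u"
  then obtain m where "match {u, v} m" using uv by (auto simp: cls_def linked_def)
  from matching_fun_add_edge[OF this, of u v] have "match {} (m(u := v, v := u))"
    using uv assms by simp
  from matching_funD(4)[OF matching_H[OF this], of u] show False
    using uv assms verts_eq by auto
qed

text \<open>A clique of \<open>G\<close> that avoids the class stays connected in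
  \<open>G - cls x\<close>, which has the same components as \<open>H - cls x\<close>.\<close>

lemma clique_no_two_components:
  assumes "x \<in> V" and "clique G A" and "A \<inter> cls x = {}"
  shows "\<not> meets_two_comps H A (cls x)"
proof
  assume "meets_two_comps H A (cls x)"
  then obtain C D u v where C: "C \<in> components (delete_verts G (cls x))" "u \<in> C" "u \<in> A"
    and D: "D \<in> components (delete_verts G (cls x))" "v \<in> D" "v \<in> A" and "C \<noteq> D"
    using components_cls[OF assms(1)] by (auto simp: meets_two_comps_def)
  have "u \<noteq> v" using C D \<open>C \<noteq> D\<close> components_eq by metis
  then have "(u, v) \<in> connected_rel (delete_verts G (cls x))"
    using C D assms by (intro connected_rel_edge) (auto simp: clique_def)
  then show False using C D \<open>C \<noteq> D\<close> components_closed components_eq by metis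
qed

lemma max_barriers_cover:
  assumes "\<forall>B\<in>\<P> G. clique G B"
  shows "\<P> G \<in> \<C> H"
proof -
  have "\<not> conflict H A B" if "A \<in> cls ` V" "B \<in> cls ` V" "A \<noteq> B" for A B
  proof -
    have "A \<inter> B = {}" using disjointD[OF partition_onD2[OF partition_cls] that] .
    moreover have "clique G A" "clique G B" using that assms max_barriers_eq by auto
    ultimately show ?thesis
      using that clique_no_two_components unfolding conflict_def by (metis Int_commute imageE)
  qed
  then show ?thesis
    using barrier_H_cls partition_cls verts_eq by (auto simp: cover_sets_def max_barriers_eq)
qed

end

section \<open>Extensions and cover sets\<close>

lemma matching_fun_of_perfect_matching:
  assumes G: "sgraph G" and M: "perfect_matching G M"
  shows "\<exists>m. matching_fun G {} m \<and> (\<forall>u v. {u, v} \<in> M \<longrightarrow> m u = v)"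
proof -
  have e: "e \<subseteq> verts G \<and> card e = 2" if "e \<in> M" for e
    using that assms by (auto simp: sgraph_def perfect_matching_def)
  have "\<exists>w. {v, w} \<in> M" if "v \<in> verts G" for v
  proof -
    obtain e where "e \<in> M" "v \<in> e" using M \<open>v \<in> verts G\<close> by (auto simp: perfect_matching_def)
    then show ?thesis using e[of e] by (auto simp: card_2_iff insert_commute)
  qed
  then obtain m where m: "{v, m v} \<in> M" if "v \<in> verts G" for v by metis
  have uniq: "m u = v" if "{u, v} \<in> M" for u v
  proof -
    have "u \<in> verts G" using e[OF that] by auto
    then have "\<exists>!e. e \<in> M \<and> u \<in> e" using M by (auto simp: perfect_matching_def)
    then have "{u, m u} = {u, v}" using m[OF \<open>u \<in> verts G\<close>] that by blast
    then show ?thesis by (auto simp: doubleton_eq_iff)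
  qed
  have "matching_fun G {} m"
    unfolding matching_fun_def
  proof (intro conjI ballI)
    fix v assume v: "v \<in> verts G"
    show "m v \<in> verts G" using e[OF m[OF v]] by auto
    show "m (m v) = v" using uniq[of "m v" v] m[OF v] by (simp add: insert_commute)
    show "m v = v \<longleftrightarrow> v \<in> {}" using e[OF m[OF v]] by auto
    show "v \<notin> {} \<longrightarrow> {v, m v} \<in> edges G" using m[OF v] M by (auto simp: perfect_matching_def)
  qed simp
  with uniq show ?thesis by blast
qed

lemma perfect_matching_of_matching_fun:
  assumes "matching_fun G {} m"
  shows "perfect_matching G ((\<lambda>v. {v, m v}) ` verts G)"
  unfolding perfect_matching_def
proof (intro conjI ballI)
  show "(\<lambda>v. {v, m v}) ` verts G \<subseteq> edges G"
    using matching_funD(4)[OF assms] by auto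
  show "\<exists>!e. e \<in> (\<lambda>v. {v, m v}) ` verts G \<and> v \<in> e" if "v \<in> verts G" for v
    using that matching_funD(2)[OF assms] by (intro ex1I[of _ "{v, m v}"]) auto
qed

text \<open>Perfect matchings of \<open>H\<close> are also perfect matchings of \<open>G\<close>.
  These sets are finite, so equal cardinalities mean equal sets.\<close>

lemma extensions_iff:
  assumes H: "sgraph H"
  shows "G \<in> \<E> H \<longleftrightarrow> sgraph G \<and> verts G = verts H \<and> edges H \<subseteq> edges G \<and>
    (\<forall>m. matching_fun G {} m \<longrightarrow> matching_fun H {} m)"
proof (cases "sgraph G \<and> verts G = verts H \<and> edges H \<subseteq> edges G")
  case False
  then show ?thesis by (auto simp: extensions_def subgraph_def)
next
  case True
  then have G: "sgraph G" "verts G = verts H" "edges H \<subseteq> edges G" by auto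
  have sub: "{M. perfect_matching H M} \<subseteq> {M. perfect_matching G M}"
    using G by (auto simp: perfect_matching_def)
  have "finite (edges G)"
    using G by (intro finite_subset[of "edges G" "Pow (verts G)"]) (auto simp: sgraph_def)
  then have fin: "finite {M. perfect_matching G M}"
    by (rule finite_subset[rotated, OF finite_Pow_iff[THEN iffD2]]) (auto simp: perfect_matching_def)
  have "\<Phi> G = \<Phi> H \<longleftrightarrow> {M. perfect_matching H M} = {M. perfect_matching G M}"
    unfolding num_pm_def using card_subset_eq[OF fin sub] by auto
  also have "\<dots> \<longleftrightarrow> (\<forall>m. matching_fun G {} m \<longrightarrow> matching_fun H {} m)"
  proof
    assume eq: "{M. perfect_matching H M} = {M. perfect_matching G M}"
    show "\<forall>m. matching_fun G {} m \<longrightarrow> matching_fun H {} m"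
    proof (intro allI impI)
      fix m assume m: "matching_fun G {} m"
      then have "perfect_matching H ((\<lambda>v. {v, m v}) ` verts G)"
        using perfect_matching_of_matching_fun[OF m] eq by blast
      then have "(\<lambda>v. {v, m v}) ` verts G \<subseteq> edges H" by (simp add: perfect_matching_def)
      then show "matching_fun H {} m"
        using m G(2) by (auto simp: matching_fun_def)
    qed
  next
    assume mf: "\<forall>m. matching_fun G {} m \<longrightarrow> matching_fun H {} m"
    have "perfect_matching H M" if M: "perfect_matching G M" for M
    proof -
      obtain m where m: "matching_fun G {} m" "\<forall>u v. {u, v} \<in> M \<longrightarrow> m u = v"
        using matching_fun_of_perfect_matching[OF G(1) M] by blast
      have "e \<in> edges H" if e: "e \<in> M" for e
      proof -
        have "e \<in> edges G" using e M by (auto simp: perfect_matching_def)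
        then obtain u v where uv: "e = {u, v}" "u \<in> verts G"
          using G(1) by (auto simp: sgraph_def card_2_iff)
        then have "m u = v" using m(2) e by blast
        moreover have "matching_fun H {} m" using mf m(1) by blast
        ultimately show ?thesis using matching_funD(4)[of H "{}" m u] uv G(2) by simp
      qed
      then show ?thesis using M G(2) by (simp add: perfect_matching_def subset_iff)
    qed
    then show "{M. perfect_matching H M} = {M. perfect_matching G M}" using sub by blast
  qed
  finally show ?thesis using G by (auto simp: extensions_def subgraph_def)
qed

lemma elementary_extensionI:
  assumes H: "sgraph H" "one_extendable H" "card (verts H) \<ge> 2" and G: "G \<in> \<E> H"
  shows "elementary_extension G H"
proof
  show ext: "\<exists>m. matching_fun H {} m \<and> m u = v" if uv: "{u, v} \<in> edges H" for u v
  proof -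
    obtain M where M: "perfect_matching H M" "{u, v} \<in> M"
      using H(2) uv by (auto simp: one_extendable_def extendable_def)
    then show ?thesis using matching_fun_of_perfect_matching[OF H(1) M(1)] by metis
  qed
  show conn: "connected_graph H" using H(2) by (simp add: one_extendable_def)
  obtain u v where uv: "u \<in> verts H" "v \<in> verts H" "u \<noteq> v"
    using H(3) by (auto simp: numeral_2_eq_2 card_le_Suc_iff)
  have "(u, v) \<in> connected_rel H" using conn uv by (auto simp: connected_graph_def)
  \<comment> \<open>A walk between two different vertices contains an edge, and every edge lies in a
    perfect matching.\<close>
  then have "v = u \<or> (\<exists>m. matching_fun H {} m)" using H(1)
    by (induction rule: connected_rel_induct) (use ext in auto)
  then show "\<exists>m. matching_fun H {} m" using uv by auto
qed (use assms extensions_iff[OF H(1)] in auto)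

section \<open>Filling the members of a cover set with edges\<close>

definition cover_extension :: "'a graph \<Rightarrow> 'a set set \<Rightarrow> 'a graph" where
  "cover_extension H I =
     \<lparr>verts = verts H, edges = edges H \<union> {{u, v} |u v. u \<noteq> v \<and> (\<exists>B\<in>I. u \<in> B \<and> v \<in> B)}\<rparr>"

lemma cover_extension_simps [simp]:
  "verts (cover_extension H I) = verts H"
  "edges (cover_extension H I) = edges H \<union> {{u, v} |u v. u \<noteq> v \<and> (\<exists>B\<in>I. u \<in> B \<and> v \<in> B)}"
  by (simp_all add: cover_extension_def)

lemma sgraph_cover_extension:
  assumes "sgraph H" and "I \<in> \<C> H"
  shows "sgraph (cover_extension H I)"
proof -
  have "B \<subseteq> verts H" if "B \<in> I" for B
    using assms that by (auto simp: cover_sets_def partition_on_def)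
  then show ?thesis using assms(1) unfolding sgraph_def by (auto simp: card_2_iff)
qed

text \<open>Since the members of a cover set do not conflict, the new edges outside \<open>B\<close> stay within
  components of \<open>H - B\<close>.\<close>

lemma barrier_cover_extension:
  assumes H: "sgraph H" and I: "I \<in> \<C> H" and B: "B \<in> I"
  shows "barrier (cover_extension H I) B"
proof -
  let ?G = "cover_extension H I"
  have bH: "barrier H B" using I B by (auto simp: cover_sets_def)
  have "connected_rel (delete_verts ?G B) \<subseteq> connected_rel (delete_verts H B)"
  proof (rule connected_rel_mono)
    show "sgraph (delete_verts ?G B)" using sgraph_delete_verts sgraph_cover_extension H I by metis
    fix u v assume uv: "{u, v} \<in> edges (delete_verts ?G B)"
    have V: "u \<in> verts (delete_verts H B)" "v \<in> verts (delete_verts H B)"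
      using uv sgraph_edgeD[OF sgraph_cover_extension[OF H I], of u v] by auto
    show "(u, v) \<in> connected_rel (delete_verts H B)"
    proof (cases "{u, v} \<in> edges H")
      case True
      then show ?thesis using V uv by (intro connected_rel_edge) auto
    next
      case False
      then obtain A where A: "A \<in> I" "u \<in> A" "v \<in> A" using uv by (auto simp: doubleton_eq_iff)
      then have "A \<noteq> B" using V by auto
      then have nm: "\<not> meets_two_comps H A B"
        using I A B by (auto simp: cover_sets_def conflict_def)
      obtain C D where C: "C \<in> components (delete_verts H B)" "u \<in> C"
        and D: "D \<in> components (delete_verts H B)" "v \<in> D"
        using components_cover V by metis
      then have "C = D" using nm A unfolding meets_two_comps_def by blast
      then show ?thesis using components_connected C D by metis
    qed
  qed simp
  moreover have "connected_rel (delete_verts H B) \<subseteq> connected_rel (delete_verts ?G B)"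
  proof (rule connected_rel_mono)
    fix u v assume "{u, v} \<in> edges (delete_verts H B)"
    then show "(u, v) \<in> connected_rel (delete_verts ?G B)"
      using sgraph_edgeD[OF H] by (intro connected_rel_edge) auto
  qed (use sgraph_delete_verts H in auto)
  ultimately show ?thesis using bH by (simp add: barrier_def odd_comps_def components_def)
qed

text \<open>Each new edge lies within a barrier of the extended graph, and no perfect matching uses
  such an edge.\<close>

lemma cover_extension_in_extensions:
  assumes H: "sgraph H" and I: "I \<in> \<C> H"
  shows "cover_extension H I \<in> \<E> H"
proof -
  let ?G = "cover_extension H I"
  have G: "sgraph ?G" using assms by (rule sgraph_cover_extension)
  have "matching_fun H {} m" if m: "matching_fun ?G {} m" for m
  proof -
    have "{v, m v} \<in> edges H" if v: "v \<in> verts H" for v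
    proof (rule ccontr)
      assume no: "{v, m v} \<notin> edges H"
      have "{v, m v} \<in> edges ?G" using matching_funD(4)[OF m, of v] v by simp
      then obtain B where B: "B \<in> I" "v \<in> B" "m v \<in> B"
        using no by (auto simp: doubleton_eq_iff)
      show False
        using barrier_no_inner_edge[OF G barrier_cover_extension[OF H I B(1)], where m = m and u = v] B m
        by blast
    qed
    then show ?thesis using m by (auto simp: matching_fun_def)
  qed
  then show ?thesis using G by (auto simp: extensions_iff[OF H])
qed

text \<open>A block caught between blocks \<open>p\<close> and \<open>p'\<close> of one partition
  forces \<open>p = p'\<close>, since blocks are nonempty and disjoint.\<close>

lemma refines_cover_antisym:
  assumes P: "partition_on A P" and Q: "partition_on A Q" and "P \<preceq> Q" and "Q \<preceq> P"
  shows "P = Q"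
proof -
  have *: "P \<subseteq> Q" if P: "partition_on A P" and PQ: "P \<preceq> Q" "Q \<preceq> P" for P Q :: "'a set set"
  proof
    fix p assume p: "p \<in> P"
    obtain q p' where q: "q \<in> Q" "p \<subseteq> q" "p' \<in> P" "q \<subseteq> p'"
      using PQ p unfolding refines_cover_def by meson
    have "p \<noteq> {}" using P p by (auto simp: partition_on_def)
    then have "p = p'" using P p q disjointD[OF partition_onD2[OF P], of p p'] by blast
    then show "p \<in> Q" using q by auto
  qed
  show ?thesis using *[of P Q] *[of Q P] assms by blast
qed

lemma graph_eqI: "verts G = verts H \<Longrightarrow> edges G = edges H \<Longrightarrow> G = (H :: 'a graph)"
  by simp

text \<open>Among the extensions above \<open>G\<close>, one with the largest number of edges is
  maximal.\<close>

lemma ex_maximal_extension: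
  assumes H: "sgraph H" and G: "G \<in> \<E> H"
  obtains G' where "maximal_in (\<E> H) subgraph G'" "subgraph G G'"
proof -
  let ?A = "{K \<in> \<E> H. subgraph G K}"
  have fin: "finite (edges K)" "edges K \<subseteq> Pow (verts H)" if "K \<in> \<E> H" for K
  proof -
    have "sgraph K" "verts K = verts H" using that extensions_iff[OF H] by auto
    then show "edges K \<subseteq> Pow (verts H)" by (metis PowI sgraph_def subsetI)
    then show "finite (edges K)" using H by (auto simp: sgraph_def intro: finite_subset)
  qed
  have "card (edges K) < Suc (card (Pow (verts H)))" if "K \<in> ?A" for K
    using that fin(2)[of K] H by (auto simp: sgraph_def less_Suc_eq_le intro!: card_mono)
  moreover have "G \<in> ?A" using G by (auto simp: subgraph_def)
  ultimately obtain K where K: "K \<in> ?A" "\<And>K'. K' \<in> ?A \<Longrightarrow> card (edges K') \<le> card (edges K)"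
    using ex_has_greatest_nat[of "\<lambda>K. K \<in> ?A" G "\<lambda>K. card (edges K)" "Suc (card (Pow (verts H)))"]
    by (metis (no_types, lifting) less_imp_le)
  have "K' = K" if K': "K' \<in> \<E> H" "subgraph K K'" for K'
  proof (rule graph_eqI)
    show "verts K' = verts K" using K K' by (auto simp: extensions_def)
    have "K' \<in> ?A" using K K' by (auto simp: subgraph_def)
    then show "edges K' = edges K"
      using card_seteq[OF fin(1)[OF K'(1)], of "edges K"] K(2) K'(2) by (auto simp: subgraph_def)
  qed
  then show thesis using that[of K] K(1) by (auto simp: maximal_in_def)
qed

lemma maximal_clique:
  assumes el: "elementary_extension G H" and max: "maximal_in (\<E> H) subgraph G"
  shows "\<forall>B\<in>\<P> G. clique G B"
proof -
  interpret elementary_extension G H by (rule el)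
  have "{u, v} \<in> edges G" if x: "x \<in> V" and uv: "u \<in> cls x" "v \<in> cls x" "u \<noteq> v" for x u v
  proof (rule ccontr)
    assume no: "{u, v} \<notin> edges G"
    define G' where "G' = \<lparr>verts = V, edges = insert {u, v} (edges G)\<rparr>"
    have uvV: "u \<in> V" "v \<in> V" using uv cls_subset by auto
    have "matching_fun H {} m" if m: "matching_fun G' {} m" for m
    proof (cases "m u = v")
      case True
      \<comment> \<open>Removing the new edge leaves a matching of \<open>G\<close> that misses
        exactly \<open>u\<close> and \<open>v\<close>, although these are not linked.\<close>
      let ?m = "m(u := u, v := v)"
      have m': "matching_fun G' {u, v} ?m"
        using matching_fun_del_edge[OF m, of u] True uvV by (simp add: G'_def)
      have "{w, ?m w} \<noteq> {u, v}" if "w \<notin> {u, v}" for w using that by (auto simp: doubleton_eq_iff)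
      then have "matching_fun G {u, v} ?m"
        using m' unfolding matching_fun_def G'_def by auto
      then show ?thesis using cls_inner[OF x uv(1,2)] uv(3) linkedI by metis
    next
      case False
      have "{w, m w} \<noteq> {u, v}" if "w \<in> V" for w
        using False matching_funD(2)[OF m, of w] that by (auto simp: doubleton_eq_iff G'_def)
      then have "matching_fun G {} m"
        using m unfolding matching_fun_def G'_def by auto
      then show ?thesis by (rule matching_H)
    qed
    moreover have "sgraph G'" using sgraph_G uvV uv(3) by (auto simp: sgraph_def G'_def)
    ultimately have "G' \<in> \<E> H"
      using edges_sub verts_eq by (auto simp: extensions_iff[OF sgraph_H] G'_def)
    moreover have "subgraph G G'" by (auto simp: subgraph_def G'_def)
    ultimately have "G' = G" using max by (auto simp: maximal_in_def)
    then have "{u, v} \<in> edges G" by (metis G'_def graph.select_convs(2) insertI1)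
    then show False using no by simp
  qed
  then show ?thesis using cls_subset by (auto simp: max_barriers_eq clique_def)
qed

theorem theorem5p5:
  fixes H G :: "'a graph"
  assumes "sgraph H" and "one_extendable H" and "card (verts H) \<ge> 2"
    and "G \<in> \<E> H"
  shows "maximal_in (\<E> H) subgraph G \<longleftrightarrow>
           (\<forall>B\<in>\<P> G. clique G B) \<and> \<P> G \<in> \<C> H \<and> maximal_in (\<C> H) (\<preceq>) (\<P> G)"
proof -
  note el = elementary_extensionI[OF assms(1-3)]
  interpret G: elementary_extension G H by (rule el[OF assms(4)])
  show ?thesis
  proof
    assume max: "maximal_in (\<E> H) subgraph G"
    have cl: "\<forall>B\<in>\<P> G. clique G B" using maximal_clique G.elementary_extension_axioms max .
    then have cov: "\<P> G \<in> \<C> H" by (rule G.max_barriers_cover)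
    have "J = \<P> G" if J: "J \<in> \<C> H" "\<P> G \<preceq> J" for J
    proof -
      \<comment> \<open>An edge of \<open>G\<close> outside \<open>H\<close> lies within a class,
        hence within a member of the coarser \<open>J\<close>.\<close>
      have "edges G \<subseteq> edges (cover_extension H J)"
      proof
        fix e assume e: "e \<in> edges G"
        then obtain u v where uv: "e = {u, v}" "u \<noteq> v" "u \<in> verts G"
          using G.sgraph_G by (auto simp: sgraph_def card_2_iff)
        show "e \<in> edges (cover_extension H J)"
        proof (cases "e \<in> edges H")
          case False
          then have "v \<in> G.cls u" "u \<in> G.cls u" using G.edge_not_H_cls e uv G.cls_self by auto
          moreover obtain B where "B \<in> J" "G.cls u \<subseteq> B"
            using J(2) uv(3) by (auto simp: refines_cover_def G.max_barriers_eq)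
          ultimately have "\<exists>B\<in>J. u \<in> B \<and> v \<in> B" by blast
          then show ?thesis unfolding cover_extension_simps using uv by blast
        qed simp
      qed
      then have "cover_extension H J = G"
        using max cover_extension_in_extensions[OF assms(1) J(1)] G.verts_eq
        by (auto simp: maximal_in_def subgraph_def)
      then have bar: "barrier G B" if "B \<in> J" for B
        using barrier_cover_extension[OF assms(1) J(1) that] by simp
      have parts: "partition_on (verts H) J" "partition_on (verts H) (\<P> G)"
        using J(1) cov by (auto simp: cover_sets_def)
      \<comment> \<open>The members of \<open>J\<close> are barriers of \<open>G\<close> and so lie
        in classes; antisymmetry then gives equality.\<close>
      have "J \<preceq> \<P> G"
        unfolding refines_cover_def
      proof
        fix B assume B: "B \<in> J"
        then have "B \<noteq> {}" using parts(1) by (auto simp: partition_on_def)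
        then obtain x where x: "x \<in> B" by auto
        then have "x \<in> verts G" using bar[OF B] by (auto simp: barrier_def)
        then show "\<exists>B'\<in>\<P> G. B \<subseteq> B'"
          using G.barrier_subset_cls[OF bar[OF B] x] by (auto simp: G.max_barriers_eq)
      qed
      then show ?thesis using refines_cover_antisym[OF parts _ J(2)] by simp
    qed
    then show "(\<forall>B\<in>\<P> G. clique G B) \<and> \<P> G \<in> \<C> H \<and> maximal_in (\<C> H) (\<preceq>) (\<P> G)"
      using cl cov by (auto simp: maximal_in_def)
  next
    assume R: "(\<forall>B\<in>\<P> G. clique G B) \<and> \<P> G \<in> \<C> H \<and> maximal_in (\<C> H) (\<preceq>) (\<P> G)"
    \<comment> \<open>It suffices to identify \<open>G\<close> with a maximal extension
      \<open>K\<close> above it.\<close>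
    obtain K where K: "maximal_in (\<E> H) subgraph K" "subgraph G K"
      using ex_maximal_extension assms(1,4) .
    interpret K: elementary_extension K H using el K(1) by (auto simp: maximal_in_def)
    have VK: "verts K = verts G" using G.verts_eq K.verts_eq by simp
    have cov: "\<P> K \<in> \<C> H"
      using K.max_barriers_cover[OF maximal_clique[OF K.elementary_extension_axioms K(1)]] .
    \<comment> \<open>Distinct vertices of a class of \<open>G\<close> are adjacent in
      \<open>G\<close> by the clique condition, but not in \<open>H\<close>, so they also share a
      class of \<open>K\<close>.\<close>
    have sub: "G.cls x \<subseteq> K.cls x" if x: "x \<in> verts G" for x
    proof
      fix v assume v: "v \<in> G.cls x"
      show "v \<in> K.cls x"
      proof (cases "v = x")
        case True
        then show ?thesis using K.cls_self x VK by simp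
      next
        case False
        have xv: "{x, v} \<in> edges G"
          using R v x False G.cls_self[OF x] by (auto simp: G.max_barriers_eq clique_def)
        have "{x, v} \<notin> edges H"
          using G.edge_linked v by (auto simp: G.cls_def)
        then show ?thesis using K.edge_not_H_cls[of x v] xv K(2) by (auto simp: subgraph_def)
      qed
    qed
    then have "\<P> G \<preceq> \<P> K"
      using VK by (auto simp: refines_cover_def G.max_barriers_eq K.max_barriers_eq)
    then have eq: "\<P> K = \<P> G" using R cov by (auto simp: maximal_in_def)
    \<comment> \<open>By \<open>eq\<close>, the edges of \<open>K\<close> outside \<open>H\<close>
      lie within classes of \<open>G\<close>, which are cliques of \<open>G\<close>.\<close>
    have "edges K \<subseteq> edges G"
    proof
      fix e assume e: "e \<in> edges K"
      then obtain u v where uv: "e = {u, v}" "u \<noteq> v" "u \<in> verts K"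
        using K.sgraph_G by (auto simp: sgraph_def card_2_iff)
      show "e \<in> edges G"
      proof (cases "e \<in> edges H")
        case True
        then show ?thesis using G.edges_sub by auto
      next
        case False
        then have "v \<in> K.cls u" "u \<in> K.cls u" using K.edge_not_H_cls e uv K.cls_self by auto
        moreover have "K.cls u \<in> \<P> G" using uv(3) eq K.max_barriers_eq by auto
        ultimately show ?thesis using R uv by (auto simp: clique_def)
      qed
    qed
    then have "K = G" using K(2) VK by (intro graph_eqI) (auto simp: subgraph_def)
    then show "maximal_in (\<E> H) subgraph G" using K(1) by simp
  qed
qed

end
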